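(* The nonlinear subdivision scheme $S_{\mathrm{PPHA}}$ is stable: it is convergent and there exists a constant $C<+\infty$ such that for all $f,g\in\ell^\infty(\mathbb{Z})$, $$\|S^\infty_{\mathrm{PPHA}}f-S^\infty_{\mathrm{PPHA}}g\|_{L^\infty(\mathbb{R})}\le C\,\|f-g\|_{\ell^\infty(\mathbb{Z})}.$$
   Context: For a real sequence $f=(f_n)_{n\in\mathbb{Z}}$ put $d^2f_n=f_{n+1}-2f_n+f_{n-1}$. The harmonic mean is the function $\mathrm{pph}:\mathbb{R}^2\to\mathbb{R}$ given by $\mathrm{pph}(x,y)=\frac{xy}{x+y}(\mathrm{sgn}(xy)+1)$, i.e. $\mathrm{pph}(x,y)=\frac{2xy}{x+y}$ if $xy>0$ and $\mathrm{pph}(x,y)=0$ if $xy\le 0$. The scheme $S_{\mathrm{PPHA}}$ maps a sequence $f$ to the sequence defined, for every $n\in\mathbb{Z}$, by: if $|d^2f_n|\ge|d^2f_{n+1}|$, $$(S_{\mathrm{PPHA}}f)_{2n}=\tfrac{49}{64}f_n+\tfrac{14}{64}f_{n+1}+\tfrac{1}{64}f_{n+2}-\tfrac{7}{64}\mathrm{pph}(d^2f_n,d^2f_{n+1}),$$ $$(S_{\mathrm{PPHA}}f)_{2n+1}=\tfrac{15}{64}f_n+\tfrac{50}{64}f_{n+1}-\tfrac{1}{64}f_{n+2}-\tfrac{5}{64}\mathrm{pph}(d^2f_n,d^2f_{n+1});$$ if $|d^2f_n|<|d^2f_{n+1}|$, $$(S_{\mathrm{PPHA}}f)_{2n}=-\tfrac{1}{64}f_{n-1}+\tfrac{15}{64}f_n+\tfrac{50}{64}f_{n+1}-\tfrac{5}{64}\mathrm{pph}(d^2f_n,d^2f_{n+1}),$$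 $$(S_{\mathrm{PPHA}}f)_{2n+1}=\tfrac{1}{64}f_{n-1}+\tfrac{49}{64}f_n+\tfrac{14}{64}f_{n+1}-\tfrac{7}{64}\mathrm{pph}(d^2f_n,d^2f_{n+1}).$$ A subdivision scheme $S:\ell^\infty(\mathbb{Z})\to\ell^\infty(\mathbb{Z})$ is convergent if for every $f\in\ell^\infty(\mathbb{Z})$ there is a function $S^\infty f\in C^0(\mathbb{R})$ (the limit function) such that $\lim_{j\to+\infty}\sup_{n\in\mathbb{Z}}|(S^jf)_n-S^\infty f(n2^{-j})|=0$, where $S^j$ is the $j$-fold iterate.
   Formalization: In the case |d²f_n| < |d²f_{n+1}| the printed weights of f_n and f_{n+1} are swapped: 50/64, 15/64 in the even rule and 14/64, 49/64 in the odd rule (mirror image of the first case); with the printed weights the scheme is discontinuous at affine data and not stable. *)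

theory Defs
  imports "HOL-Probability.Essential_Supremum"
begin

definition linf :: "(int \<Rightarrow> real) set" where
  "linf = {f. bounded (range f)}"

definition linf_norm :: "(int \<Rightarrow> real) \<Rightarrow> ereal" where
  "linf_norm f = (SUP n. ereal \<bar>f n\<bar>)"

definition Linf_norm :: "(real \<Rightarrow> real) \<Rightarrow> ereal" where
  "Linf_norm F = esssup lborel (\<lambda>x. ereal \<bar>F x\<bar>)"

definition d2 :: "(int \<Rightarrow> real) \<Rightarrow> int \<Rightarrow> real" where
  "d2 f n = f (n + 1) - 2 * f n + f (n - 1)"

text \<open>When \<open>x + y = 0\<close> the last factor vanishes or \<open>x = y = 0\<close>, so the convention for
  division by zero does not affect the value.\<close>

definition pph :: "real \<Rightarrow> real \<Rightarrow> real" where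
  "pph x y = x * y / (x + y) * (sgn (x * y) + 1)"

lemma pph_cases: "pph x y = (if x * y > 0 then 2 * x * y / (x + y) else 0)"
  by (auto simp: pph_def sgn_if)

text \<open>
  The branch for \<open>\<bar>d2 f n\<bar> < \<bar>d2 f (n + 1)\<bar>\<close> is the mirror image of the other one
  under \<open>k \<mapsto> 2 * n + 1 - k\<close>, which exchanges the even and the odd rule.
  Thus \<open>f n\<close> has weight 50/64 in the even rule and 14/64 in the odd rule, and
  \<open>f (n + 1)\<close> has weight 15/64 in the even rule and 49/64 in the odd rule.
  The source prints these weights of \<open>f n\<close> and \<open>f (n + 1)\<close> transposed (15, 50 in the even
  rule, 49, 14 in the odd one), a misprint: the resulting map is discontinuous, for instance
  at sequences that are locally affine and not constant.  With the weights below,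
  replacing the harmonic by the arithmetic mean gives in both branches the linear scheme
  with even rule (-7, 105, 35, -5)/128 and odd rule (-5, 35, 105, -7)/128.
\<close>

definition S_PPHA :: "(int \<Rightarrow> real) \<Rightarrow> int \<Rightarrow> real" where
  "S_PPHA f m =
    (let n = m div 2; p = pph (d2 f n) (d2 f (n + 1)) in
     if \<bar>d2 f n\<bar> \<ge> \<bar>d2 f (n + 1)\<bar> then
       (if even m
        then 49/64 * f n + 14/64 * f (n + 1) + 1/64 * f (n + 2) - 7/64 * p
        else 15/64 * f n + 50/64 * f (n + 1) - 1/64 * f (n + 2) - 5/64 * p)
     else
       (if even m
        then - 1/64 * f (n - 1) + 50/64 * f n + 15/64 * f (n + 1) - 5/64 * p
        else 1/64 * f (n - 1) + 14/64 * f n + 49/64 * f (n + 1) - 7/64 * p))"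

definition is_limit_function ::
  "((int \<Rightarrow> real) \<Rightarrow> int \<Rightarrow> real) \<Rightarrow> (int \<Rightarrow> real) \<Rightarrow> (real \<Rightarrow> real) \<Rightarrow> bool" where
  "is_limit_function S f F \<longleftrightarrow> continuous_on UNIV F \<and>
     (\<lambda>j. linf_norm (\<lambda>n. (S ^^ j) f n - F (of_int n / 2 ^ j))) \<longlonglongrightarrow> 0"

definition convergent_scheme :: "((int \<Rightarrow> real) \<Rightarrow> int \<Rightarrow> real) \<Rightarrow> bool" where
  "convergent_scheme S \<longleftrightarrow> (\<forall>f\<in>linf. \<exists>F. is_limit_function S f F)"

definition limit_function ::
  "((int \<Rightarrow> real) \<Rightarrow> int \<Rightarrow> real) \<Rightarrow> (int \<Rightarrow> real) \<Rightarrow> real \<Rightarrow> real" where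
  "limit_function S f = (THE F. is_limit_function S f F)"

lemma is_limit_function_pointwise:
  assumes "is_limit_function S f F"
  shows "(\<lambda>j. (S ^^ j) f \<lfloor>2 ^ j * x\<rfloor>) \<longlonglongrightarrow> F x"
proof -
  define y :: "nat \<Rightarrow> real" where "y j = of_int \<lfloor>2 ^ j * x\<rfloor> / 2 ^ j" for j
  define N where "N j = linf_norm (\<lambda>n. (S ^^ j) f n - F (of_int n / 2 ^ j))" for j
  have "\<bar>y j - x\<bar> \<le> (1/2) ^ j" for j
  proof -
    have "\<bar>of_int \<lfloor>2 ^ j * x\<rfloor> - 2 ^ j * x\<bar> \<le> 1" by linarith
    moreover have "y j - x = (of_int \<lfloor>2 ^ j * x\<rfloor> - 2 ^ j * x) / 2 ^ j"
      by (simp add: y_def field_simps)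
    ultimately show ?thesis by (simp add: power_one_over divide_right_mono)
  qed
  moreover have "(\<lambda>j. (1/2 :: real) ^ j) \<longlonglongrightarrow> 0" by (simp add: LIMSEQ_power_zero)
  ultimately have "(\<lambda>j. y j - x) \<longlonglongrightarrow> 0"
    by (intro Lim_null_comparison[of "\<lambda>j. y j - x"]) auto
  then have "y \<longlonglongrightarrow> x" by (simp add: LIM_zero_iff)
  moreover have "isCont F x"
    using assms by (simp add: is_limit_function_def continuous_on_eq_continuous_at)
  ultimately have Fy: "(\<lambda>j. F (y j)) \<longlonglongrightarrow> F x" by (rule isCont_tendsto_compose[rotated])
  have "N \<longlonglongrightarrow> 0" using assms by (simp add: is_limit_function_def N_def[abs_def])
  then have N: "N \<longlonglongrightarrow> ereal 0" by (simp add: zero_ereal_def)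
  have up: "\<forall>\<^sub>F j in sequentially. ereal \<bar>(S ^^ j) f \<lfloor>2 ^ j * x\<rfloor> - F (y j)\<bar> \<le> N j"
    unfolding N_def linf_norm_def y_def by (intro always_eventually allI SUP_upper) simp
  have lo: "\<forall>\<^sub>F j in sequentially. ereal 0 \<le> ereal \<bar>(S ^^ j) f \<lfloor>2 ^ j * x\<rfloor> - F (y j)\<bar>"
    by (intro always_eventually allI) simp
  have "(\<lambda>j. ereal \<bar>(S ^^ j) f \<lfloor>2 ^ j * x\<rfloor> - F (y j)\<bar>) \<longlonglongrightarrow> ereal 0"
    by (rule tendsto_sandwich[OF lo up tendsto_const N])
  then have "(\<lambda>j. (S ^^ j) f \<lfloor>2 ^ j * x\<rfloor> - F (y j)) \<longlonglongrightarrow> 0"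
    unfolding lim_ereal by (rule tendsto_rabs_zero_cancel)
  from tendsto_add[OF this Fy] show ?thesis by simp
qed

lemma is_limit_function_unique:
  assumes "is_limit_function S f F" "is_limit_function S f G"
  shows "F = G"
  using LIMSEQ_unique[OF assms[THEN is_limit_function_pointwise]] by blast

lemma limit_function_eq: "is_limit_function S f F \<Longrightarrow> limit_function S f = F"
  unfolding limit_function_def by (blast intro: is_limit_function_unique)

lemma abs_pph_le: "\<bar>pph x y\<bar> \<le> 2 * \<bar>x\<bar>"
proof (cases "x * y > 0")
  case True
  then have "x + y \<noteq> 0" and "\<bar>y\<bar> \<le> \<bar>x + y\<bar>" by (auto simp: zero_less_mult_iff)
  then have "\<bar>x\<bar> * \<bar>y\<bar> / \<bar>x + y\<bar> \<le> \<bar>x\<bar>"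
    by (simp add: divide_le_eq mult_left_mono)
  with True show ?thesis by (simp add: pph_cases abs_mult)
qed (simp add: pph_cases)

lemma S_PPHA_linf:
  assumes "f \<in> linf"
  shows "S_PPHA f \<in> linf"
proof -
  obtain B where B: "\<And>n. \<bar>f n\<bar> \<le> B"
    using assms by (auto simp: linf_def bounded_iff)
  have "\<bar>S_PPHA f m\<bar> \<le> 3 * B" for m
  proof -
    define n where "n = m div 2"
    define p where "p = pph (d2 f n) (d2 f (n + 1))"
    have "\<bar>p\<bar> \<le> 2 * \<bar>d2 f n\<bar>" by (simp add: p_def abs_pph_le)
    moreover have "\<bar>d2 f n\<bar> \<le> 4 * B"
      using B[of "n + 1"] B[of n] B[of "n - 1"] by (simp add: d2_def)
    ultimately have p: "p \<le> 8 * B" "- p \<le> 8 * B" by linarith+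
    have f: "f k \<le> B" "- f k \<le> B" for k using B[of k] by linarith+
    note le = p f[of "n - 1"] f[of n] f[of "n + 1"] f[of "n + 2"]
    have "\<bar>49/64 * f n + 14/64 * f (n + 1) + 1/64 * f (n + 2) - 7/64 * p\<bar> \<le> 3 * B"
      by (rule abs_leI) (use le in linarith)+
    moreover have "\<bar>15/64 * f n + 50/64 * f (n + 1) - 1/64 * f (n + 2) - 5/64 * p\<bar> \<le> 3 * B"
      by (rule abs_leI) (use le in linarith)+
    moreover have "\<bar>- 1/64 * f (n - 1) + 50/64 * f n + 15/64 * f (n + 1) - 5/64 * p\<bar> \<le> 3 * B"
      by (rule abs_leI) (use le in linarith)+
    moreover have "\<bar>1/64 * f (n - 1) + 14/64 * f n + 49/64 * f (n + 1) - 7/64 * p\<bar> \<le> 3 * B"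
      by (rule abs_leI) (use le in linarith)+
    ultimately show ?thesis
      unfolding S_PPHA_def Let_def n_def[symmetric] p_def[symmetric] by (simp only: split: if_split) blast
  qed
  then show ?thesis by (auto simp: linf_def bounded_iff)
qed

end

theory Submission
  imports Defs
begin

text \<open>
  The scheme is the linear Chaikin scheme with weights \<open>3/4, 1/4\<close>, which does not increase the
  supremum norm, plus a Lipschitz correction depending only on the second differences.
  The second differences of the refined sequence therefore depend only on those of the old one,
  by a rule in three variables that is nondecreasing in the middle one. Its slopes lie in
  \<open>[-13, 1]/64\<close>, \<open>[5, 25]/64\<close> and \<open>[-3, 15]/64\<close>, so that one step contracts distances between
  second differences by \<open>(13 + 25 + 15)/64 = 53/64 < 1\<close>. Summing the corrections as a geometric
  series gives a Lipschitz bound uniform in the number of steps; since the first differences decay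
  at the same rate, the iterates, viewed as step functions on the dyadic grids, converge
  uniformly to a continuous limit.
\<close>

section \<open>Symmetric and antisymmetric parts of the nonlinear correction\<close>

text \<open>
  With \<open>pph\<close> symmetric and \<open>qph\<close> antisymmetric, the two branches of the scheme merge: the corrections
  are \<open>(- 6 * pph + qph)/64\<close> in the even rule and \<open>(- 6 * pph - qph)/64\<close> in the odd rule.
\<close>

definition qph :: "real \<Rightarrow> real \<Rightarrow> real" where
  "qph x y = (if \<bar>y\<bar> \<le> \<bar>x\<bar> then y - pph x y else pph x y - x)"

lemma pph_commute: "pph x y = pph y x"
  by (simp add: pph_def mult.commute add.commute)

lemma pph_minus: "pph (- x) (- y) = - pph x y"
proof -
  have "2 * x * y / (- x - y) = - (2 * x * y / (x + y))"
    by (metis minus_add_distrib diff_conv_add_uminus divide_minus_right)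
  then show ?thesis by (simp add: pph_cases)
qed

text \<open>Swapping the arguments swaps the branches unless \<open>|x| = |y|\<close>. For
  \<open>x = y\<close> both sides vanish because \<open>pph x x = x\<close>; for
  \<open>x = - y\<close> the mean is 0 and the values are \<open>y\<close> and
  \<open>x\<close>.\<close>

lemma qph_antisym: "qph x y = - qph y x"
proof (cases "\<bar>x\<bar> = \<bar>y\<bar>")
  case True
  then have "x = y \<or> x = - y" by linarith
  then show ?thesis by (auto simp: qph_def pph_cases zero_less_mult_iff mult_less_0_iff)
qed (auto simp: qph_def pph_commute)

lemma qph_minus: "qph (- x) (- y) = - qph x y"
  by (simp add: qph_def pph_minus)

section \<open>Slope bounds in one variable\<close>

lemma mono_on_Un:
  fixes k :: "real \<Rightarrow> real"
  assumes "mono_on A k" "mono_on B k" "c \<in> A" "c \<in> B"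
    and "\<And>a. a \<in> A \<Longrightarrow> a \<le> c" "\<And>b. b \<in> B \<Longrightarrow> c \<le> b"
  shows "mono_on (A \<union> B) k"
proof (rule mono_onI)
  fix r s assume "r \<in> A \<union> B" "s \<in> A \<union> B" "r \<le> s"
  then consider "r \<in> A" "s \<in> A" | "r \<in> B" "s \<in> B" | "r \<in> A" "s \<in> B"
    | "r \<in> B" "s \<in> A" by blast
  then show "k r \<le> k s"
  proof cases
    case 3
    then show ?thesis using assms by (meson mono_onD order_trans)
  next
    case 4
    then have "r = c" "s = c" using assms(5)[of s] assms(6)[of r] \<open>r \<le> s\<close> by auto
    then show ?thesis by simp
  qed (use assms \<open>r \<le> s\<close> in \<open>auto dest: mono_onD\<close>)
qed

text \<open>An exact difference quotient, used in place of a derivative. The factor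
  \<open>y\<^sup>2 / ((u + y) * (v + y))\<close> lies in [1/4, 1] when \<open>u\<close> and
  \<open>v\<close> are at most \<open>y\<close>, and in [0, 1/4] when both are at least
  \<open>y\<close>.\<close>

lemma harmonic_increment:
  fixes u v y :: real
  assumes "0 \<le> u" "0 \<le> v" "0 < y"
  shows "2 * v * y / (v + y) - 2 * u * y / (u + y) = 2 * (y\<^sup>2 / ((u + y) * (v + y))) * (v - u)"
  using assms by (simp add: divide_simps add_pos_nonneg power2_eq_square) (simp add: algebra_simps)

text \<open>
  For fixed \<open>y > 0\<close> the combination is smooth in \<open>x\<close> on the pieces cut out by \<open>- y, 0, y\<close>; its slopes
  there are \<open>0\<close>, \<open>- \<beta>\<close>, a value between \<open>(\<alpha> - \<beta>) / 2\<close> and \<open>2 * \<alpha> + \<beta>\<close>, and a value between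
  \<open>0\<close> and \<open>(\<alpha> - \<beta>) / 2\<close>.
\<close>

lemma comb_slope_le_pos:
  fixes \<alpha> \<beta> c y :: real
  assumes c: "0 \<le> c" "- \<beta> \<le> c" "(\<alpha> - \<beta>) / 2 \<le> c" "2 * \<alpha> + \<beta> \<le> c" and y: "0 < y"
  shows "mono (\<lambda>x. c * x - (\<alpha> * pph x y + \<beta> * qph x y))"
proof -
  define k where "k x = c * x - (\<alpha> * pph x y + \<beta> * qph x y)" for x
  have pos: "pph x y = 2 * x * y / (x + y)" if "0 \<le> x" for x
    using that y by (auto simp: pph_cases zero_less_mult_iff)
  have neg: "pph x y = 0" if "x \<le> 0" for x
    using that y by (auto simp: pph_cases zero_less_mult_iff)
  have k1: "k x = c * x - \<beta> * y" if "x \<le> - y" for x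
    using that y by (simp add: k_def qph_def neg)
  \<comment> \<open>At \<open>x = - y\<close> the definition of \<open>qph\<close> takes the other
    branch, but the formulas agree there, so the closed pieces share an endpoint for gluing.\<close>
  have k2: "k x = c * x + \<beta> * x" if "- y \<le> x" "x \<le> 0" for x
  proof (cases "x = - y")
    case False
    then have "\<not> \<bar>y\<bar> \<le> \<bar>x\<bar>" using that by linarith
    then show ?thesis using that by (simp add: k_def qph_def neg)
  qed (use y in \<open>simp add: k_def qph_def neg\<close>)
  have k3: "k x = (c + \<beta>) * x - (\<alpha> + \<beta>) * (2 * x * y / (x + y))" if "0 \<le> x" "x \<le> y" for x
  proof (cases "x = y")
    case False
    then have "\<not> \<bar>y\<bar> \<le> \<bar>x\<bar>" using that by linarith
    then show ?thesis using that by (simp add: k_def qph_def pos algebra_simps add_divide_distrib)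
  qed (use y in \<open>simp add: k_def qph_def pos algebra_simps\<close>)
  have k4: "k x = c * x - \<beta> * y - (\<alpha> - \<beta>) * (2 * x * y / (x + y))" if "y \<le> x" for x
    using that y by (simp add: k_def qph_def pos algebra_simps diff_divide_distrib)
  have m1: "mono_on {..- y} k"
    using c by (intro mono_onI) (simp add: k1 mult_left_mono)
  have m2: "mono_on {- y..0} k"
  proof (intro mono_onI)
    fix u v assume "u \<in> {- y..0}" "v \<in> {- y..0}" "u \<le> v"
    moreover from this have "(c + \<beta>) * u \<le> (c + \<beta>) * v" using c by (intro mult_left_mono) auto
    ultimately show "k u \<le> k v" by (simp add: k2 algebra_simps)
  qed
  have m3: "mono_on {0..y} k"
  proof (intro mono_onI)
    fix u v assume uv: "u \<in> {0..y}" "v \<in> {0..y}" "u \<le> v"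
    define t where "t = y\<^sup>2 / ((u + y) * (v + y))"
    have "y\<^sup>2 \<le> (u + y) * (v + y)"
      unfolding power2_eq_square using uv y by (intro mult_mono) auto
    then have t1: "t \<le> 1" using uv y by (simp add: t_def divide_le_eq add_nonneg_pos)
    have "(u + y) * (v + y) \<le> (2 * y) * (2 * y)" using uv y by (intro mult_mono) auto
    then have t2: "1 / 4 \<le> t"
      using uv y by (simp add: t_def le_divide_eq add_nonneg_pos power2_eq_square)
    \<comment> \<open>Linear in \<open>t\<close>, so an endpoint of [1/4, 1] is the worst case:
      \<open>t = 1\<close> requires \<open>2 * \<alpha> + \<beta> \<le> c\<close>, and
      \<open>t = 1/4\<close> requires \<open>(\<alpha> - \<beta>) / 2 \<le> c\<close>.\<close>
    have "2 * ((\<alpha> + \<beta>) * t) \<le> c + \<beta>"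
    proof (cases "\<alpha> + \<beta> \<ge> 0")
      case True
      then have "(\<alpha> + \<beta>) * t \<le> (\<alpha> + \<beta>) * 1" using t1 by (intro mult_left_mono)
      also have "2 * \<dots> \<le> c + \<beta>" using c by simp
      finally show ?thesis by simp
    next
      case False
      then have "(\<alpha> + \<beta>) * t \<le> (\<alpha> + \<beta>) * (1 / 4)" using t2 by (intro mult_left_mono_neg) auto
      also have "2 * \<dots> \<le> c + \<beta>" using c by (simp add: field_simps)
      finally show ?thesis by simp
    qed
    then have "0 \<le> (c + \<beta> - 2 * ((\<alpha> + \<beta>) * t)) * (v - u)" using uv by simp
    also have "\<dots> = (c + \<beta>) * (v - u) - (\<alpha> + \<beta>) * (2 * t * (v - u))" by (simp add: algebra_simps)
    also have "\<dots> = (c + \<beta>) * (v - u) - (\<alpha> + \<beta>) * (2 * v * y / (v + y) - 2 * u * y / (u + y))"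
      using uv y by (subst harmonic_increment) (auto simp: t_def)
    also have "\<dots> = k v - k u"
      using uv by (simp only: k3 atLeastAtMost_iff) (simp add: right_diff_distrib)
    finally show "k u \<le> k v" by simp
  qed
  have m4: "mono_on {y..} k"
  proof (intro mono_onI)
    fix u v assume uv: "u \<in> {y..}" "v \<in> {y..}" "u \<le> v"
    define t where "t = y\<^sup>2 / ((u + y) * (v + y))"
    have t1: "0 \<le> t" using uv y by (simp add: t_def)
    have "(2 * y) * (2 * y) \<le> (u + y) * (v + y)" using uv y by (intro mult_mono) auto
    then have t2: "t \<le> 1 / 4"
      using uv y by (simp add: t_def divide_le_eq add_nonneg_pos power2_eq_square)
    have "2 * ((\<alpha> - \<beta>) * t) \<le> c"
    proof (cases "\<alpha> - \<beta> \<ge> 0")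
      case True
      then have "(\<alpha> - \<beta>) * t \<le> (\<alpha> - \<beta>) * (1 / 4)" using t2 by (intro mult_left_mono)
      also have "2 * \<dots> \<le> c" using c by (simp add: field_simps)
      finally show ?thesis by simp
    next
      case False
      then have "(\<alpha> - \<beta>) * t \<le> 0" using t1 by (simp add: mult_le_0_iff)
      then show ?thesis using c by linarith
    qed
    then have "0 \<le> (c - 2 * ((\<alpha> - \<beta>) * t)) * (v - u)" using uv by simp
    also have "\<dots> = c * (v - u) - (\<alpha> - \<beta>) * (2 * t * (v - u))" by (simp add: algebra_simps)
    also have "\<dots> = c * (v - u) - (\<alpha> - \<beta>) * (2 * v * y / (v + y) - 2 * u * y / (u + y))"
      using uv y by (subst harmonic_increment) (auto simp: t_def)
    also have "\<dots> = k v - k u"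
      using uv by (simp only: k4 atLeast_iff) (simp add: right_diff_distrib)
    finally show "k u \<le> k v" by simp
  qed
  have "mono_on ({..- y} \<union> {- y..0}) k"
    by (rule mono_on_Un[OF m1 m2, of "- y"]) (use y in simp_all)
  then have "mono_on ({..- y} \<union> {- y..0} \<union> {0..y}) k"
    by (rule mono_on_Un[OF _ m3, of _ 0]) (use y in auto)
  then have "mono_on ({..- y} \<union> {- y..0} \<union> {0..y} \<union> {y..}) k"
    by (rule mono_on_Un[OF _ m4, of _ y]) (use y in auto)
  moreover have "{..- y} \<union> {- y..0} \<union> {0..y} \<union> {y..} = UNIV" by auto
  ultimately show ?thesis by (simp add: k_def[abs_def])
qed

text \<open>Both functions are odd under negating the two arguments together, which reduces
  \<open>y < 0\<close> to \<open>y > 0\<close>; for \<open>y = 0\<close> both vanish.\<close>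

lemma comb_slope_le:
  fixes \<alpha> \<beta> c y :: real
  assumes c: "0 \<le> c" "- \<beta> \<le> c" "(\<alpha> - \<beta>) / 2 \<le> c" "2 * \<alpha> + \<beta> \<le> c" and "u \<le> v"
  shows "(\<alpha> * pph v y + \<beta> * qph v y) - (\<alpha> * pph u y + \<beta> * qph u y) \<le> c * (v - u)"
proof -
  consider "0 < y" | "y = 0" | "0 < - y" by linarith
  then show ?thesis
  proof cases
    case 1
    from monoD[OF comb_slope_le_pos[OF c this] \<open>u \<le> v\<close>] show ?thesis by (simp add: algebra_simps)
  next
    case 2
    then show ?thesis using c \<open>u \<le> v\<close> by (simp add: qph_def pph_cases)
  next
    case 3
    have "- v \<le> - u" using \<open>u \<le> v\<close> by simp
    from monoD[OF comb_slope_le_pos[OF c 3] this] show ?thesis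
      by (simp add: pph_minus qph_minus algebra_simps)
  qed
qed

lemma comb_slope_pos:
  fixes \<alpha> \<beta> y :: real
  assumes "u < v" and hi: "0 \<le> hi" "- \<beta> \<le> hi" "(\<alpha> - \<beta>) / 2 \<le> hi" "2 * \<alpha> + \<beta> \<le> hi"
    and lo: "lo \<le> 0" "lo \<le> - \<beta>" "lo \<le> (\<alpha> - \<beta>) / 2" "lo \<le> 2 * \<alpha> + \<beta>"
  shows "\<exists>s\<in>{lo..hi}. (\<alpha> * pph v y + \<beta> * qph v y) - (\<alpha> * pph u y + \<beta> * qph u y) = s * (v - u)"
proof -
  define d where "d = (\<alpha> * pph v y + \<beta> * qph v y) - (\<alpha> * pph u y + \<beta> * qph u y)"
  have "d \<le> hi * (v - u)"
    unfolding d_def using assms by (intro comb_slope_le) auto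
  \<comment> \<open>The upper bound applied to the coefficients \<open>- \<alpha>\<close> and
    \<open>- \<beta>\<close>.\<close>
  moreover have "lo * (v - u) \<le> d"
    using comb_slope_le[of "- lo" "- \<beta>" "- \<alpha>" u v y] assms by (simp add: d_def field_simps)
  ultimately have "d / (v - u) \<in> {lo..hi}" using \<open>u < v\<close> by (simp add: divide_le_eq le_divide_eq)
  moreover have "d = d / (v - u) * (v - u)" using \<open>u < v\<close> by simp
  ultimately show ?thesis unfolding d_def by blast
qed

text \<open>Stated as an equation with a slope, so that slopes of several terms in the same variable
  can be added with their signs.\<close>

lemma comb_slope:
  fixes \<alpha> \<beta> y :: real
  assumes hi: "0 \<le> hi" "- \<beta> \<le> hi" "(\<alpha> - \<beta>) / 2 \<le> hi" "2 * \<alpha> + \<beta> \<le> hi"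
    and lo: "lo \<le> 0" "lo \<le> - \<beta>" "lo \<le> (\<alpha> - \<beta>) / 2" "lo \<le> 2 * \<alpha> + \<beta>"
  obtains s where "lo \<le> s" "s \<le> hi"
    "(\<alpha> * pph v y + \<beta> * qph v y) - (\<alpha> * pph u y + \<beta> * qph u y) = s * (v - u)"
proof -
  consider "u < v" | "u = v" | "v < u" by linarith
  then have "\<exists>s\<in>{lo..hi}. (\<alpha> * pph v y + \<beta> * qph v y) - (\<alpha> * pph u y + \<beta> * qph u y) = s * (v - u)"
  proof cases
    case 1
    then show ?thesis by (rule comb_slope_pos) (fact hi lo)+
  next
    case 2
    then show ?thesis using hi lo by (intro bexI[of _ 0]) auto
  next
    case 3
    then have "\<exists>s\<in>{lo..hi}. (\<alpha> * pph u y + \<beta> * qph u y) - (\<alpha> * pph v y + \<beta> * qph v y) = s * (u - v)"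
      by (rule comb_slope_pos) (fact hi lo)+
    then obtain s where "s \<in> {lo..hi}"
      "(\<alpha> * pph u y + \<beta> * qph u y) - (\<alpha> * pph v y + \<beta> * qph v y) = s * (u - v)" ..
    then show ?thesis by (intro bexI[of _ s]) (simp_all add: right_diff_distrib)
  qed
  then show ?thesis using that by auto
qed

section \<open>Lipschitz and contraction constants\<close>

lemma abs_mult_le_mult:
  fixes s :: real
  assumes "\<bar>s\<bar> \<le> c" "\<bar>a\<bar> \<le> d"
  shows "\<bar>s * a\<bar> \<le> c * d"
  using mult_mono'[OF assms] by (simp add: abs_mult)

definition even_corr :: "real \<Rightarrow> real \<Rightarrow> real" where
  "even_corr x y = (- 6 * pph x y + qph x y) / 64"

text \<open>\<open>y / 4\<close> comes from the Chaikin weights; the corrections, weighted 1, -2, 1,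
  are those of three consecutive refined values.\<close>

definition d2_rule :: "real \<Rightarrow> real \<Rightarrow> real \<Rightarrow> real" where
  "d2_rule x y z = y / 4 + even_corr z y - 2 * even_corr y z + even_corr y x"

lemma even_corr_swap: "even_corr y x = (- 6 * pph x y - qph x y) / 64"
  by (simp add: even_corr_def pph_commute[of y x] qph_antisym[of y x])

text \<open>One argument changes at a time, with slopes in [-11, 0]/64 and [-13, 1]/64; the constant
  is (11 + 13)/64.\<close>

lemma even_corr_lipschitz:
  assumes "\<bar>x - x'\<bar> \<le> d" "\<bar>y - y'\<bar> \<le> d"
  shows "\<bar>even_corr x y - even_corr x' y'\<bar> \<le> 3 / 8 * d"
proof -
  obtain s where s: "- 11 \<le> s" "s \<le> 0"
    "(- 6 * pph x y + 1 * qph x y) - (- 6 * pph x' y + 1 * qph x' y) = s * (x - x')"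
    by (rule comb_slope[of 0 1 "- 6" "- 11" x y x']) auto
  obtain t where t: "- 13 \<le> t" "t \<le> 1"
    "(- 6 * pph y x' + - 1 * qph y x') - (- 6 * pph y' x' + - 1 * qph y' x') = t * (y - y')"
    by (rule comb_slope[of 1 "- 1" "- 6" "- 13" y x' y']) auto
  have "64 * even_corr x y - 64 * even_corr x' y' = s * (x - x') + t * (y - y')"
    unfolding s(3)[symmetric] t(3)[symmetric] even_corr_swap[of x' y']
    by (simp add: even_corr_def pph_commute[of x'] qph_antisym[of x' y] diff_divide_distrib)
  moreover have "\<bar>s * (x - x')\<bar> \<le> 11 * d" using s assms by (intro abs_mult_le_mult) auto
  moreover have "\<bar>t * (y - y')\<bar> \<le> 13 * d" using t assms by (intro abs_mult_le_mult) auto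
  ultimately show ?thesis by linarith
qed

lemma d2_rule_contraction:
  assumes "\<bar>x - x'\<bar> \<le> d" "\<bar>y - y'\<bar> \<le> d" "\<bar>z - z'\<bar> \<le> d"
  shows "\<bar>d2_rule x y z - d2_rule x' y' z'\<bar> \<le> 53 / 64 * d"
proof -
  have eq: "64 * d2_rule x y z = 16 * y + (6 * pph y z + - 3 * qph y z) + (- 6 * pph y x + 1 * qph y x)" for x y z
    unfolding d2_rule_def even_corr_swap[of z y]
    by (simp add: even_corr_def add_divide_distrib diff_divide_distrib)
  obtain r where r: "- 13 \<le> r" "r \<le> 1"
    "(- 6 * pph x y' + - 1 * qph x y') - (- 6 * pph x' y' + - 1 * qph x' y') = r * (x - x')"
    by (rule comb_slope[of 1 "- 1" "- 6" "- 13" x y' x']) auto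
  obtain s where s: "0 \<le> s" "s \<le> 9"
    "(6 * pph y z + - 3 * qph y z) - (6 * pph y' z + - 3 * qph y' z) = s * (y - y')"
    by (rule comb_slope[of 9 "- 3" 6 0 y z y']) auto
  obtain s' where s': "- 11 \<le> s'" "s' \<le> 0"
    "(- 6 * pph y x + 1 * qph y x) - (- 6 * pph y' x + 1 * qph y' x) = s' * (y - y')"
    by (rule comb_slope[of 0 1 "- 6" "- 11" y x y']) auto
  obtain t where t: "- 3 \<le> t" "t \<le> 15"
    "(6 * pph z y' + 3 * qph z y') - (6 * pph z' y' + 3 * qph z' y') = t * (z - z')"
    by (rule comb_slope[of 15 3 6 "- 3" z y' z']) auto
  \<comment> \<open>The middle variable moves first, then the outer two at \<open>y'\<close>. Its
    slopes are added before taking absolute values, giving 25; bounding them separately would give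
    16 + 9 + 11 = 36 and a total of 64, hence no contraction.\<close>
  have "64 * d2_rule x y z - 64 * d2_rule x' y' z' = r * (x - x') + (16 + s + s') * (y - y') + t * (z - z')"
    unfolding eq distrib_right[of _ _ "y - y'"]
      r(3)[symmetric] s(3)[symmetric] s'(3)[symmetric] t(3)[symmetric]
    by (simp add: pph_commute[of _ y'] qph_antisym[of _ y'])
  moreover have "\<bar>r * (x - x')\<bar> \<le> 13 * d" using r assms by (intro abs_mult_le_mult) auto
  moreover have "\<bar>(16 + s + s') * (y - y')\<bar> \<le> 25 * d" using s s' assms by (intro abs_mult_le_mult) auto
  moreover have "\<bar>t * (z - z')\<bar> \<le> 15 * d" using t assms by (intro abs_mult_le_mult) auto
  ultimately show ?thesis by linarith
qed

lemma even_corr_0 [simp]: "even_corr 0 0 = 0"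
  by (simp add: even_corr_def pph_cases qph_def)

section \<open>The scheme as Chaikin plus correction\<close>

text \<open>The linear stencils differ from the weights 48/64, 16/64 by
  \<open>d2 f (n + 1) / 64\<close> or \<open>- d2 f n / 64\<close>, which is the linear part of
  \<open>qph\<close> in the respective branch.\<close>

lemma S_PPHA_even:
  "S_PPHA f (2 * n) = 3/4 * f n + 1/4 * f (n + 1) + even_corr (d2 f n) (d2 f (n + 1))"
proof (cases "\<bar>d2 f (n + 1)\<bar> \<le> \<bar>d2 f n\<bar>")
  case True
  then show ?thesis by (simp add: S_PPHA_def Let_def even_corr_def qph_def) (simp add: d2_def field_simps)
next
  case False
  then show ?thesis by (simp add: S_PPHA_def Let_def even_corr_def qph_def) (simp add: d2_def field_simps)
qed

lemma S_PPHA_odd: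
  "S_PPHA f (2 * n + 1) = 1/4 * f n + 3/4 * f (n + 1) + even_corr (d2 f (n + 1)) (d2 f n)"
proof (cases "\<bar>d2 f (n + 1)\<bar> \<le> \<bar>d2 f n\<bar>")
  case True
  then show ?thesis
    unfolding even_corr_swap by (simp add: S_PPHA_def Let_def qph_def) (simp add: d2_def field_simps)
next
  case False
  then show ?thesis
    unfolding even_corr_swap by (simp add: S_PPHA_def Let_def qph_def) (simp add: d2_def field_simps)
qed

lemma d2_S_PPHA_even:
  "d2 (S_PPHA f) (2 * n) = d2_rule (d2 f (n - 1)) (d2 f n) (d2 f (n + 1))"
proof -
  have "2 * n - 1 = 2 * (n - 1) + 1" by simp
  then have "d2 (S_PPHA f) (2 * n) = S_PPHA f (2 * n + 1) - 2 * S_PPHA f (2 * n) + S_PPHA f (2 * (n - 1) + 1)"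
    by (simp only: d2_def)
  then show ?thesis
    unfolding S_PPHA_even S_PPHA_odd d2_rule_def by (simp add: d2_def[of f n])
qed

text \<open>Reflection exchanges even and odd values, so the same rule appears with its arguments in
  reversed order.\<close>

lemma d2_S_PPHA_odd:
  "d2 (S_PPHA f) (2 * n + 1) = d2_rule (d2 f (n + 2)) (d2 f (n + 1)) (d2 f n)"
proof -
  have "2 * n + 1 + 1 = 2 * (n + 1)" "2 * n + 1 - 1 = 2 * n" by simp_all
  then have "d2 (S_PPHA f) (2 * n + 1) = S_PPHA f (2 * (n + 1)) - 2 * S_PPHA f (2 * n + 1) + S_PPHA f (2 * n)"
    by (simp only: d2_def)
  then show ?thesis
    unfolding S_PPHA_even S_PPHA_odd d2_rule_def by (simp add: d2_def[of f "n + 1"] add.assoc)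
qed

lemma int_even_odd_cases:
  fixes m :: int
  obtains n where "m = 2 * n" | n where "m = 2 * n + 1"
  by (metis evenE oddE)

section \<open>Stability of the iterates, uniformly in the level\<close>

lemma d2_S_PPHA_contraction:
  assumes "\<And>n. \<bar>d2 f n - d2 g n\<bar> \<le> d"
  shows "\<bar>d2 (S_PPHA f) m - d2 (S_PPHA g) m\<bar> \<le> 53 / 64 * d"
  by (cases m rule: int_even_odd_cases)
    (simp_all only: d2_S_PPHA_even d2_S_PPHA_odd, (intro d2_rule_contraction assms)+)

text \<open>The Chaikin part is a convex combination and contributes \<open>e\<close>; the
  correction sees only second differences.\<close>

lemma S_PPHA_diff_le:
  assumes "\<And>n. \<bar>f n - g n\<bar> \<le> e" and "\<And>n. \<bar>d2 f n - d2 g n\<bar> \<le> d"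
  shows "\<bar>S_PPHA f m - S_PPHA g m\<bar> \<le> e + 3 / 8 * d"
proof (cases m rule: int_even_odd_cases)
  case (1 n)
  show ?thesis
    unfolding 1 S_PPHA_even
    using even_corr_lipschitz[OF assms(2)[of n] assms(2)[of "n + 1"]] assms(1)[of n] assms(1)[of "n + 1"]
    by linarith
next
  case (2 n)
  show ?thesis
    unfolding 2 S_PPHA_odd
    using even_corr_lipschitz[OF assms(2)[of "n + 1"] assms(2)[of n]] assms(1)[of n] assms(1)[of "n + 1"]
    by linarith
qed

lemma d2_diff_le:
  assumes "\<And>n. \<bar>f n - g n\<bar> \<le> e"
  shows "\<bar>d2 f n - d2 g n\<bar> \<le> 4 * e"
  using assms[of "n - 1"] assms[of n] assms[of "n + 1"] unfolding d2_def by linarith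

lemma d2_S_PPHA_pow:
  assumes "\<And>n. \<bar>f n - g n\<bar> \<le> e"
  shows "\<bar>d2 ((S_PPHA ^^ j) f) n - d2 ((S_PPHA ^^ j) g) n\<bar> \<le> 4 * e * (53 / 64) ^ j"
proof (induction j arbitrary: n)
  case 0
  then show ?case using d2_diff_le[OF assms] by simp
next
  case (Suc j)
  from d2_S_PPHA_contraction[OF this] show ?case by (simp add: mult_ac)
qed

text \<open>The constant is \<open>1 + 3/8 * 4 * 64/11\<close>, from summing the geometric series.\<close>

lemma S_PPHA_pow_diff_le:
  assumes "\<And>n. \<bar>f n - g n\<bar> \<le> e"
  shows "\<bar>(S_PPHA ^^ j) f n - (S_PPHA ^^ j) g n\<bar> \<le> 107 / 11 * e"
proof -
  have e: "0 \<le> e" using assms[of 0] by linarith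
  \<comment> \<open>The partial geometric sum is kept exactly, since the final bound alone would not
    pass through the induction.\<close>
  have "\<bar>(S_PPHA ^^ j) f n - (S_PPHA ^^ j) g n\<bar> \<le> e + 96 / 11 * e * (1 - (53 / 64) ^ j)"
  proof (induction j arbitrary: n)
    case 0
    then show ?case using assms by simp
  next
    case (Suc j)
    have "(S_PPHA ^^ Suc j) h = S_PPHA ((S_PPHA ^^ j) h)" for h by simp
    then have "\<bar>(S_PPHA ^^ Suc j) f n - (S_PPHA ^^ Suc j) g n\<bar>
      \<le> e + 96 / 11 * e * (1 - (53 / 64) ^ j) + 3 / 8 * (4 * e * (53 / 64) ^ j)"
      by (simp only: S_PPHA_diff_le[OF Suc d2_S_PPHA_pow[OF assms]])
    also have "\<dots> = e + 96 / 11 * e * (1 - (53 / 64) ^ Suc j)"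
      by (simp add: algebra_simps)
    finally show ?case .
  qed
  also have "\<dots> \<le> e + 96 / 11 * e"
    using e by (intro add_left_mono mult_left_le) auto
  also have "\<dots> = 107 / 11 * e" by simp
  finally show ?thesis .
qed

section \<open>Decay of differences and existence of the limit\<close>

lemma d2_S_PPHA_pow_le:
  assumes "\<And>n. \<bar>f n\<bar> \<le> e"
  shows "\<bar>d2 ((S_PPHA ^^ j) f) n\<bar> \<le> 4 * e * (53 / 64) ^ j"
proof -
  \<comment> \<open>Zero is a fixed point, so decay is the comparison with
    \<open>g = 0\<close>.\<close>
  have S0: "S_PPHA (\<lambda>_. 0) = (\<lambda>_. 0)"
    by (rule ext) (simp add: S_PPHA_def pph_cases d2_def Let_def)
  have "(S_PPHA ^^ j) (\<lambda>_. 0) = (\<lambda>_. 0)" by (induction j) (simp_all add: S0)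
  then show ?thesis using d2_S_PPHA_pow[of f "\<lambda>_. 0" e j n] assms by (simp add: d2_def)
qed

lemma even_corr_le:
  assumes "\<bar>x\<bar> \<le> d" "\<bar>y\<bar> \<le> d"
  shows "\<bar>even_corr x y\<bar> \<le> 3 / 8 * d"
  using even_corr_lipschitz[of x 0 d y 0] assms by simp

text \<open>Chaikin halves first differences; each of the two corrections adds at most
  \<open>3 / 8 * d\<close>.\<close>

lemma S_PPHA_step_le:
  assumes "\<And>n. \<bar>f (n + 1) - f n\<bar> \<le> e" and d: "\<And>n. \<bar>d2 f n\<bar> \<le> d"
  shows "\<bar>S_PPHA f (m + 1) - S_PPHA f m\<bar> \<le> 1 / 2 * e + 3 / 4 * d"
proof (cases m rule: int_even_odd_cases)
  case (1 n)
  show ?thesis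
    unfolding 1 S_PPHA_even S_PPHA_odd
    using even_corr_le[OF d[of n] d[of "n + 1"]] even_corr_le[OF d[of "n + 1"] d[of n]] assms(1)[of n]
    by linarith
next
  case (2 n)
  have "m + 1 = 2 * (n + 1)" using 2 by simp
  then show ?thesis
    unfolding 2 S_PPHA_odd using S_PPHA_even[of f "n + 1"]
      even_corr_le[OF d[of "n + 1"] d[of "n + 1 + 1"]] even_corr_le[OF d[of "n + 1"] d[of n]]
      assms(1)[of n] assms(1)[of "n + 1"]
    by (simp only:)
qed

text \<open>The factor 10 absorbs the second differences: 10/2 + 4 * 3/4 = 8, which is below 10 *
  53/64.\<close>

lemma S_PPHA_pow_step_le:
  assumes "\<And>n. \<bar>f n\<bar> \<le> e"
  shows "\<bar>(S_PPHA ^^ j) f (n + 1) - (S_PPHA ^^ j) f n\<bar> \<le> 10 * e * (53 / 64) ^ j"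
proof (induction j arbitrary: n)
  case 0
  have "\<bar>f (n + 1) - f n\<bar> \<le> 10 * e" using assms[of n] assms[of "n + 1"] by linarith
  then show ?case by simp
next
  case (Suc j)
  have "0 \<le> e" using assms[of 0] by linarith
  then have "0 \<le> e * (53 / 64) ^ j" by simp
  moreover from S_PPHA_step_le[OF Suc d2_S_PPHA_pow_le[OF assms]]
  have "\<bar>(S_PPHA ^^ Suc j) f (n + 1) - (S_PPHA ^^ Suc j) f n\<bar> \<le> 8 * (e * (53 / 64) ^ j)"
    by simp
  ultimately show ?case by simp
qed

text \<open>\<open>m div 2\<close> indexes the parent dyadic cell, so this compares consecutive step
  functions; the weight 3/4 occurs at odd \<open>m\<close>.\<close>

lemma S_PPHA_refine_le:
  assumes e: "\<And>n. \<bar>f (n + 1) - f n\<bar> \<le> e" and d: "\<And>n. \<bar>d2 f n\<bar> \<le> d"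
  shows "\<bar>S_PPHA f m - f (m div 2)\<bar> \<le> 3 / 4 * e + 3 / 8 * d"
proof (cases m rule: int_even_odd_cases)
  case (1 n)
  then have "m div 2 = n" by simp
  then show ?thesis
    unfolding 1 S_PPHA_even using even_corr_le[OF d[of n] d[of "n + 1"]] e[of n]
    by simp
next
  case (2 n)
  then have "m div 2 = n" by simp
  then show ?thesis
    unfolding 2 S_PPHA_odd using even_corr_le[OF d[of "n + 1"] d[of n]] e[of n]
    by simp
qed

lemma S_PPHA_pow_refine_le:
  assumes "\<And>n. \<bar>f n\<bar> \<le> e"
  shows "\<bar>(S_PPHA ^^ Suc j) f m - (S_PPHA ^^ j) f (m div 2)\<bar> \<le> 9 * e * (53 / 64) ^ j"
proof -
  have "\<bar>S_PPHA ((S_PPHA ^^ j) f) m - (S_PPHA ^^ j) f (m div 2)\<bar>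
    \<le> 3 / 4 * (10 * e * (53 / 64) ^ j) + 3 / 8 * (4 * e * (53 / 64) ^ j)"
    by (rule S_PPHA_refine_le[OF S_PPHA_pow_step_le[OF assms] d2_S_PPHA_pow_le[OF assms]])
  then show ?thesis by simp
qed

lemma floor_double_div_2: "\<lfloor>2 * x\<rfloor> div 2 = \<lfloor>x :: real\<rfloor>"
  using floor_divide_real_eq_div[of 2 "2 * x"] by simp

text \<open>Telescoping along the nested dyadic cells containing \<open>x\<close>; 576/11 is 9 *
  64/11 from the geometric sum.\<close>

lemma S_PPHA_pow_cauchy:
  fixes x :: real
  assumes "\<And>n. \<bar>f n\<bar> \<le> e"
  shows "\<bar>(S_PPHA ^^ (j + k)) f \<lfloor>2 ^ (j + k) * x\<rfloor> - (S_PPHA ^^ j) f \<lfloor>2 ^ j * x\<rfloor>\<bar>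
    \<le> 576 / 11 * e * (53 / 64) ^ j * (1 - (53 / 64) ^ k)"
proof (induction k)
  case (Suc k)
  have "\<lfloor>2 ^ (j + Suc k) * x\<rfloor> div 2 = \<lfloor>2 ^ (j + k) * x\<rfloor>"
    using floor_double_div_2[of "2 ^ (j + k) * x"] by (simp add: mult_ac)
  with S_PPHA_pow_refine_le[OF assms, where j = "j + k" and m = "\<lfloor>2 ^ (j + Suc k) * x\<rfloor>"]
  have "\<bar>(S_PPHA ^^ (j + Suc k)) f \<lfloor>2 ^ (j + Suc k) * x\<rfloor> - (S_PPHA ^^ (j + k)) f \<lfloor>2 ^ (j + k) * x\<rfloor>\<bar>
    \<le> 9 * e * (53 / 64) ^ (j + k)" by simp
  then have "\<bar>(S_PPHA ^^ (j + Suc k)) f \<lfloor>2 ^ (j + Suc k) * x\<rfloor> - (S_PPHA ^^ j) f \<lfloor>2 ^ j * x\<rfloor>\<bar>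
    \<le> 9 * e * (53 / 64) ^ (j + k) + 576 / 11 * e * (53 / 64) ^ j * (1 - (53 / 64) ^ k)"
    using Suc by linarith
  also have "\<dots> = 576 / 11 * (e * (53 / 64) ^ j - e * (53 / 64) ^ j * (53 / 64) ^ Suc k)"
    unfolding power_add by (simp add: right_diff_distrib)
  also have "\<dots> = 576 / 11 * e * (53 / 64) ^ j * (1 - (53 / 64) ^ Suc k)"
    by (simp only: right_diff_distrib mult.assoc mult_1_right)
  finally show ?case .
qed simp

lemma S_PPHA_limit_exists:
  assumes "f \<in> linf"
  shows "\<exists>F. is_limit_function S_PPHA f F"
proof -
  obtain e where e: "\<And>n. \<bar>f n\<bar> \<le> e"
    using assms by (auto simp: linf_def bounded_iff)
  have e0: "0 \<le> e" using e[of 0] by linarith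
  define G where "G j x = (S_PPHA ^^ j) f \<lfloor>2 ^ j * x\<rfloor>" for j and x :: real
  define c where "c = 576 / 11 * e"
  have c0: "0 \<le> c" using e0 by (simp add: c_def)
  have G: "\<bar>G (j + k) x - G j x\<bar> \<le> c * (53 / 64) ^ j" for j k x
  proof -
    have "\<bar>G (j + k) x - G j x\<bar> \<le> c * (53 / 64) ^ j * (1 - (53 / 64) ^ k)"
      unfolding G_def c_def by (rule S_PPHA_pow_cauchy[OF e])
    also have "\<dots> \<le> c * (53 / 64) ^ j" using c0 by (intro mult_left_le) auto
    finally show ?thesis .
  qed
  have c_lim: "(\<lambda>j. C * (53 / 64) ^ j) \<longlonglongrightarrow> 0" for C :: real
    by (intro tendsto_mult_right_zero LIMSEQ_power_zero) simp
  have "Cauchy (\<lambda>j. G j x)" for x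
  proof (rule metric_CauchyI)
    fix r :: real assume "0 < r"
    from order_tendstoD(2)[OF c_lim[of "2 * c"] this] obtain N where N: "2 * c * (53 / 64) ^ N < r"
      by (auto simp: eventually_sequentially)
    show "\<exists>M. \<forall>m\<ge>M. \<forall>n\<ge>M. dist (G m x) (G n x) < r"
    proof (intro exI allI impI)
      fix m n assume "N \<le> m" "N \<le> n"
      then obtain k l where "m = N + k" "n = N + l" by (auto simp: le_iff_add)
      then show "dist (G m x) (G n x) < r"
        using G[of N k x] G[of N l x] N unfolding dist_real_def by (simp only:)
    qed
  qed
  then have "\<exists>L. (\<lambda>j. G j x) \<longlonglongrightarrow> L" for x by (simp add: Cauchy_convergent_iff convergent_def)
  then obtain F where F: "\<And>x. (\<lambda>j. G j x) \<longlonglongrightarrow> F x" by metis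
  have FG: "\<bar>F x - G j x\<bar> \<le> c * (53 / 64) ^ j" for j x
  proof -
    have "(\<lambda>k. G (j + k) x) \<longlonglongrightarrow> F x" using LIMSEQ_ignore_initial_segment[OF F, of j] by (simp add: add.commute)
    then have "(\<lambda>k. \<bar>G (j + k) x - G j x\<bar>) \<longlonglongrightarrow> \<bar>F x - G j x\<bar>" by (intro tendsto_intros)
    then show ?thesis by (rule LIMSEQ_le_const2) (use G in auto)
  qed
  \<comment> \<open>Points at most one cell width apart lie in equal or adjacent cells, so a single
    first difference bounds the jump.\<close>
  have G_step: "\<bar>G j x - G j y\<bar> \<le> 10 * e * (53 / 64) ^ j" if "\<bar>x - y\<bar> \<le> 1 / 2 ^ j" for j x y
  proof -
    have "2 ^ j * \<bar>x - y\<bar> \<le> 1" using that by (simp add: field_simps)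
    then have "\<bar>2 ^ j * x - 2 ^ j * y\<bar> \<le> 1" by (simp add: abs_mult flip: right_diff_distrib)
    then have "\<lfloor>2 ^ j * x\<rfloor> = \<lfloor>2 ^ j * y\<rfloor> \<or> \<lfloor>2 ^ j * x\<rfloor> = \<lfloor>2 ^ j * y\<rfloor> + 1 \<or> \<lfloor>2 ^ j * y\<rfloor> = \<lfloor>2 ^ j * x\<rfloor> + 1"
      by linarith
    then show ?thesis
      using S_PPHA_pow_step_le[OF e, where j = j and n = "\<lfloor>2 ^ j * x\<rfloor>"]
        S_PPHA_pow_step_le[OF e, where j = j and n = "\<lfloor>2 ^ j * y\<rfloor>"] e0
      by (auto simp: G_def abs_minus_commute)
  qed
  have "continuous_on UNIV F"
    unfolding continuous_on_iff
  proof (intro ballI allI impI)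
    fix x r :: real assume "0 < r"
    \<comment> \<open>Two approximation errors \<open>c\<close> and one jump \<open>10 * e\<close>
      of the step function at level \<open>N\<close>.\<close>
    from order_tendstoD(2)[OF c_lim[of "2 * c + 10 * e"] this]
    obtain N where N: "(2 * c + 10 * e) * (53 / 64) ^ N < r" by (auto simp: eventually_sequentially)
    show "\<exists>d>0. \<forall>x'\<in>UNIV. dist x' x < d \<longrightarrow> dist (F x') (F x) < r"
    proof (intro exI[of _ "1 / 2 ^ N"] conjI ballI impI)
      fix x' assume "dist x' x < 1 / 2 ^ N"
      then have "\<bar>G N x' - G N x\<bar> \<le> 10 * e * (53 / 64) ^ N" by (intro G_step) (simp add: dist_real_def)
      moreover have "2 * (c * (53 / 64) ^ N) + 10 * e * (53 / 64) ^ N < r"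
        using N by (simp add: algebra_simps)
      ultimately show "dist (F x') (F x) < r"
        using FG[of x' N] FG[of x N] unfolding dist_real_def by linarith
    qed simp
  qed
  moreover have "(\<lambda>j. linf_norm (\<lambda>n. (S_PPHA ^^ j) f n - F (of_int n / 2 ^ j))) \<longlonglongrightarrow> 0"
  proof (rule tendsto_sandwich[OF _ _ tendsto_const])
    show "(\<lambda>j. ereal (c * (53 / 64) ^ j)) \<longlonglongrightarrow> 0"
      unfolding zero_ereal_def lim_ereal by (rule c_lim)
    have "0 \<le> linf_norm h" for h
      unfolding linf_norm_def by (rule SUP_upper2[of 0]) auto
    then show "\<forall>\<^sub>F j in sequentially. 0 \<le> linf_norm (\<lambda>n. (S_PPHA ^^ j) f n - F (of_int n / 2 ^ j))"
      by simp
    \<comment> \<open>At a grid point the step function takes the value of the iterate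
      itself.\<close>
    have "\<bar>(S_PPHA ^^ j) f n - F (of_int n / 2 ^ j)\<bar> \<le> c * (53 / 64) ^ j" for j n
      using FG[of "of_int n / 2 ^ j" j] by (simp add: G_def abs_minus_commute)
    then have "linf_norm (\<lambda>n. (S_PPHA ^^ j) f n - F (of_int n / 2 ^ j)) \<le> ereal (c * (53 / 64) ^ j)" for j
      unfolding linf_norm_def by (intro SUP_least) simp
    then show "\<forall>\<^sub>F j in sequentially. linf_norm (\<lambda>n. (S_PPHA ^^ j) f n - F (of_int n / 2 ^ j))
        \<le> ereal (c * (53 / 64) ^ j)"
      by (intro always_eventually allI)
  qed
  ultimately show ?thesis unfolding is_limit_function_def by blast
qed

section \<open>Stability of the limit functions\<close>

lemma linf_norm_diff_real:
  assumes "f \<in> linf" "g \<in> linf"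
  obtains e where "linf_norm (\<lambda>n. f n - g n) = ereal e" "\<And>n. \<bar>f n - g n\<bar> \<le> e"
proof -
  obtain a b where ab: "\<And>n. \<bar>f n\<bar> \<le> a" "\<And>n. \<bar>g n\<bar> \<le> b"
    using assms by (auto simp: linf_def bounded_iff)
  have up: "ereal \<bar>f n - g n\<bar> \<le> linf_norm (\<lambda>n. f n - g n)" for n
    unfolding linf_norm_def by (rule SUP_upper) simp
  have "\<bar>f n - g n\<bar> \<le> a + b" for n using ab(1)[of n] ab(2)[of n] by linarith
  then have "linf_norm (\<lambda>n. f n - g n) \<le> ereal (a + b)"
    unfolding linf_norm_def by (intro SUP_least) simp
  \<comment> \<open>The value at index 0 excludes minus infinity, the upper bound excludes
    infinity.\<close>
  with up[of 0] obtain e where e: "linf_norm (\<lambda>n. f n - g n) = ereal e"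
    by (cases "linf_norm (\<lambda>n. f n - g n)") auto
  with up show thesis by (intro that) auto
qed

lemma S_PPHA_limit_diff_le:
  assumes F: "is_limit_function S_PPHA f F" and G: "is_limit_function S_PPHA g G"
    and e: "\<And>n. \<bar>f n - g n\<bar> \<le> e"
  shows "\<bar>F x - G x\<bar> \<le> 107 / 11 * e"
proof -
  have "(\<lambda>j. \<bar>(S_PPHA ^^ j) f \<lfloor>2 ^ j * x\<rfloor> - (S_PPHA ^^ j) g \<lfloor>2 ^ j * x\<rfloor>\<bar>) \<longlonglongrightarrow> \<bar>F x - G x\<bar>"
    by (intro tendsto_intros is_limit_function_pointwise F G)
  then show ?thesis by (rule LIMSEQ_le_const2) (use S_PPHA_pow_diff_le[OF e] in auto)
qed

theorem theorem4:
  shows "convergent_scheme S_PPHA \<and>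
    (\<exists>C::real. \<forall>f\<in>linf. \<forall>g\<in>linf.
       Linf_norm (\<lambda>x. limit_function S_PPHA f x - limit_function S_PPHA g x)
         \<le> ereal C * linf_norm (\<lambda>n. f n - g n))"
proof (intro conjI exI[of _ "107 / 11"] ballI)
  show "convergent_scheme S_PPHA"
    by (simp add: convergent_scheme_def S_PPHA_limit_exists)
next
  fix f g assume fg: "f \<in> linf" "g \<in> linf"
  obtain F G where F: "is_limit_function S_PPHA f F" and G: "is_limit_function S_PPHA g G"
    using fg S_PPHA_limit_exists by blast
  obtain e where e: "linf_norm (\<lambda>n. f n - g n) = ereal e" "\<And>n. \<bar>f n - g n\<bar> \<le> e"
    using linf_norm_diff_real[OF fg] by blast
  have "continuous_on UNIV F" "continuous_on UNIV G"
    using F G by (simp_all add: is_limit_function_def)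
  \<comment> \<open>Bounding the essential supremum by a pointwise bound requires measurability,
    here from continuity.\<close>
  then have [measurable]: "F \<in> borel_measurable borel" "G \<in> borel_measurable borel"
    by (simp_all add: borel_measurable_continuous_onI)
  have "Linf_norm (\<lambda>x. F x - G x) \<le> ereal (107 / 11 * e)"
    unfolding Linf_norm_def
    by (rule esssup_I) (use S_PPHA_limit_diff_le[OF F G e(2)] in simp_all)
  then show "Linf_norm (\<lambda>x. limit_function S_PPHA f x - limit_function S_PPHA g x)
      \<le> ereal (107 / 11) * linf_norm (\<lambda>n. f n - g n)"
    by (simp add: limit_function_eq[OF F] limit_function_eq[OF G] e(1))
qed

end
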